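(* Let $x\in\mathbb{C}$ with $|x|=1$ and $|\arg x|\leq\frac{2\pi}{3}$. Then for every $\alpha\in(0,1)$ and every natural number $n\geq 1$, $$|A_{2n-1}(\alpha,x)|\leq A_{2n-1}(\alpha,1).$$
   Context: For $\alpha>0$ and $x\in\mathbb{C}$ with $|x|=1$, the numbers $A_m(\alpha,x)$ are the coefficients of the Maclaurin expansion $$\frac{(1+xz)^\alpha}{1-z}=\sum_{m=0}^\infty A_m(\alpha,x)z^m,\qquad |z|<1,$$ where the power is the principal branch. Equivalently, $A_m(\alpha,x)=\sum_{k=0}^{m}\frac{(-\alpha)_k(-x)^k}{k!}$, where $(a)_0=1$ and $(a)_k=a(a+1)\cdots(a+k-1)$ for $k\ge 1$. In particular $A_m(\alpha,1)$ is real. Here $\arg x\in(-\pi,\pi]$ is the principal argument. *)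

theory Defs
  imports "HOL-Complex_Analysis.Complex_Analysis"
begin

definition A_coeff :: "nat \<Rightarrow> real \<Rightarrow> complex \<Rightarrow> complex" where
  "A_coeff m \<alpha> x =
     fps_nth (fps_expansion (\<lambda>z. (1 + x * z) powr complex_of_real \<alpha> / (1 - z)) 0) m"

lemma A_coeff_eq_sum:
  "A_coeff m \<alpha> x = (\<Sum>k\<le>m. pochhammer (- complex_of_real \<alpha>) k * (- x) ^ k / fact k)"
proof -
  let ?a = "complex_of_real \<alpha>"
  let ?G = "fps_compose (fps_binomial ?a) (fps_const x * fps_X)"
  have lin: "(\<lambda>z. x * z) has_fps_expansion fps_const x * fps_X"
    by (intro fps_expansion_intros)
  have "((\<lambda>z. (1 + z) powr ?a) \<circ> (\<lambda>z. x * z)) has_fps_expansion ?G"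
    by (intro has_fps_expansion_compose lin has_fps_expansion_binomial_complex) auto
  moreover have "(\<lambda>z::complex. inverse (1 - z)) has_fps_expansion inverse (1 - fps_X)"
    by (intro fps_expansion_intros) auto
  ultimately have "(\<lambda>z. (1 + x * z) powr ?a / (1 - z)) has_fps_expansion ?G * inverse (1 - fps_X)"
    using has_fps_expansion_mult by (fastforce simp: o_def divide_inverse)
  hence "A_coeff m \<alpha> x = fps_nth (?G * inverse (1 - fps_X)) m"
    unfolding A_coeff_def by (simp only: fps_expansion_eqI)
  also have "inverse (1 - fps_X :: complex fps) = Abs_fps (\<lambda>_. 1)"
    by (rule fps_inverse_one_minus_fps_X)
  also have "fps_nth (?G * Abs_fps (\<lambda>_. 1)) m = (\<Sum>k\<le>m. x ^ k * (?a gchoose k))"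
    unfolding fps_compose_linear fps_mult_nth by (simp add: atLeast0AtMost)
  also have "\<dots> = (\<Sum>k\<le>m. pochhammer (- ?a) k * (- x) ^ k / fact k)"
    by (simp add: gbinomial_pochhammer power_minus[of x] mult_ac)
  finally show ?thesis .
qed

lemma A_coeff_one_in_Reals: "A_coeff m \<alpha> 1 \<in> \<real>"
proof -
  have "pochhammer (- complex_of_real \<alpha>) k * (- 1) ^ k / fact k
      = complex_of_real (pochhammer (- \<alpha>) k * (- 1) ^ k / fact k)" for k
    using pochhammer_of_real[of "- \<alpha>" k, where 'a = complex] by simp
  then have "A_coeff m \<alpha> 1
      = complex_of_real (\<Sum>k\<le>m. pochhammer (- \<alpha>) k * (- 1) ^ k / fact k)"
    by (simp only: A_coeff_eq_sum of_real_sum)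
  then show ?thesis
    by (metis Reals_of_real)
qed

end

theory Submission
  imports Defs
begin

text \<open>
  Up to sign, the binomial coefficients of order k + 1 with upper index \<open>\<alpha> \<in> (0, 1)\<close> are the
  moments of order k of a positive measure \<open>\<mu>\<close> on the unit interval (Beta integral). Summing the
  tail of the binomial series gives, for odd m and \<open>|z| < 1\<close>,
  \<open>A\<^sub>m(\<alpha>, z) = (1 + z)\<^sup>\<alpha> + z\<^sup>m\<^sup>+\<^sup>1 \<integral> t\<^sup>m / (1 + t z) d\<mu>(t)\<close>. Put \<open>z = r x\<close> and \<open>u = 1 - Re x\<close>.
  Compared with its value at \<open>x = 1\<close>, the modulus of the first term loses at least \<open>\<alpha> r u / 4\<close>.
  Since \<open>Re x \<ge> -1/2\<close>, we have \<open>1 / |1 + s x| \<le> 1 / (1 + s) + u / 2\<close> for \<open>0 \<le> s \<le> 1\<close>, and the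
  moment of order m is at most \<open>\<alpha> / 2\<close>, so the second term gains at most \<open>\<alpha> r u / 4\<close>.
  Finally r tends to 1.
\<close>

section \<open>The Beta-type measure and its moments\<close>

text \<open>For \<open>0 < \<alpha> < 1\<close> this is the Beta distribution with parameters
  \<open>1 - \<alpha>\<close> and \<open>1 + \<alpha>\<close>, rescaled to total mass
  \<open>\<alpha>\<close>, the binomial coefficient of order 1. The constant in front equals
  \<open>sin (pi * \<alpha>) / pi\<close>.\<close>

definition binomial_measure :: "real \<Rightarrow> real measure" where
  "binomial_measure \<alpha> = density lborel
     (\<lambda>t. ennreal (\<alpha> / Beta (1 - \<alpha>) (1 + \<alpha>) * (indicator {0..1} t * (t powr (- \<alpha>) * (1 - t) powr \<alpha>))))"

lemma sets_binomial_measure [measurable_cong, simp]: "sets (binomial_measure \<alpha>) = sets borel"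
  by (simp add: binomial_measure_def)

lemma space_binomial_measure [simp]: "space (binomial_measure \<alpha>) = UNIV"
  by (simp add: binomial_measure_def)

lemma Beta_real_pos: "a > 0 \<Longrightarrow> b > 0 \<Longrightarrow> Beta a (b::real) > 0"
  by (simp add: Beta_def)

lemma AE_binomial_measure: "AE t in binomial_measure \<alpha>. 0 \<le> t \<and> t \<le> 1"
  unfolding binomial_measure_def by (subst AE_density) (auto split: split_indicator)

lemma has_bochner_integral_Beta:
  assumes "a > 0" "b > (0::real)"
  shows "has_bochner_integral lborel (\<lambda>t. indicator {0..1} t * (t powr (a - 1) * (1 - t) powr (b - 1))) (Beta a b)"
proof -
  have i: "set_integrable lborel {0..1} (\<lambda>t. t powr (a - 1) * (1 - t) powr (b - 1))"
    by (rule integrable_Beta[OF assms])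
  have "(LINT t:{0..1}|lborel. t powr (a - 1) * (1 - t) powr (b - 1)) = Beta a b"
    using set_borel_integral_eq_integral(2)[OF i] has_integral_Beta_real[OF assms]
    by (simp add: integral_unique)
  with i show ?thesis
    by (simp add: has_bochner_integral_iff set_integrable_def set_lebesgue_integral_def)
qed

lemma finite_measure_binomial_measure:
  assumes "0 < \<alpha>" "\<alpha> < 1"
  shows "finite_measure (binomial_measure \<alpha>)"
proof
  let ?f = "\<lambda>t. \<alpha> / Beta (1 - \<alpha>) (1 + \<alpha>) * (indicator {0..1} t * (t powr (- \<alpha>) * (1 - t) powr \<alpha>))"
  have "integrable lborel ?f"
    using has_bochner_integral_Beta[of "1 - \<alpha>" "1 + \<alpha>"] assms
    by (auto simp: has_bochner_integral_iff)
  moreover have "0 \<le> ?f t" for t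
    using assms Beta_real_pos[of "1 - \<alpha>" "1 + \<alpha>"] by auto
  ultimately have "(\<integral>\<^sup>+ t. ennreal (?f t) \<partial>lborel) = ennreal (LINT t|lborel. ?f t)"
    by (intro nn_integral_eq_integral) auto
  then show "emeasure (binomial_measure \<alpha>) (space (binomial_measure \<alpha>)) \<noteq> \<infinity>"
    by (simp add: binomial_measure_def emeasure_density)
qed

text \<open>Both sides equal \<open>\<alpha>\<close> at \<open>k = 0\<close> and obey the same
  recurrence: going from \<open>k\<close> to \<open>k + 1\<close> multiplies them by
  \<open>- (1 - \<alpha> + k) / (k + 2)\<close>. On the Beta side this is the rule for raising the
  first argument by one, the two arguments having sum \<open>k + 2\<close>.\<close>

lemma gbinomial_Suc_eq_Beta:
  fixes \<alpha> :: real
  assumes "0 < \<alpha>" "\<alpha> < 1"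
  shows "\<alpha> gchoose Suc k = (- 1) ^ k * (\<alpha> / Beta (1 - \<alpha>) (1 + \<alpha>) * Beta (1 - \<alpha> + real k) (1 + \<alpha>))"
proof (induction k)
  case 0
  then show ?case using Beta_real_pos[of "1 - \<alpha>" "1 + \<alpha>"] assms by simp
next
  case (Suc k)
  have rec: "(real k + 2) * Beta (1 - \<alpha> + real (Suc k)) (1 + \<alpha>)
      = (1 - \<alpha> + real k) * Beta (1 - \<alpha> + real k) (1 + \<alpha>)"
  proof -
    have "1 - \<alpha> + real k \<notin> \<int>\<^sub>\<le>\<^sub>0"
      using assms by (auto dest: nonpos_Ints_nonpos)
    from Beta_plus1_left[OF this, of "1 + \<alpha>"] show ?thesis
      by (simp add: algebra_simps)
  qed
  have "(real k + 2) * (\<alpha> gchoose Suc (Suc k)) = - ((1 - \<alpha> + real k) * (\<alpha> gchoose Suc k))"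
    using gbinomial_mult_1[of \<alpha> "Suc k"] by (simp add: algebra_simps)
  also have "\<dots> = (- 1) ^ Suc k * (\<alpha> / Beta (1 - \<alpha>) (1 + \<alpha>)
      * ((1 - \<alpha> + real k) * Beta (1 - \<alpha> + real k) (1 + \<alpha>)))"
    unfolding Suc.IH by simp
  also have "\<dots> = (real k + 2) * ((- 1) ^ Suc k * (\<alpha> / Beta (1 - \<alpha>) (1 + \<alpha>)
      * Beta (1 - \<alpha> + real (Suc k)) (1 + \<alpha>)))"
    unfolding rec[symmetric] by simp
  finally show ?case
    by (subst (asm) mult_left_cancel) auto
qed

lemma gbinomial_Suc_eq_moment:
  assumes "0 < \<alpha>" "\<alpha> < 1"
  shows "\<alpha> gchoose Suc k = (- 1) ^ k * (LINT t|binomial_measure \<alpha>. t ^ k)"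
proof -
  let ?c = "\<alpha> / Beta (1 - \<alpha>) (1 + \<alpha>)"
  have "?c \<ge> 0"
    using assms Beta_real_pos[of "1 - \<alpha>" "1 + \<alpha>"] by auto
  then have "(LINT t|binomial_measure \<alpha>. t ^ k)
      = (LINT t|lborel. ?c * (indicator {0..1} t * (t powr (- \<alpha>) * (1 - t) powr \<alpha>)) * t ^ k)"
    unfolding binomial_measure_def by (subst integral_density) (auto intro!: mult_nonneg_nonneg simp del: times_divide_eq_left)
  also have "\<dots> = (LINT t|lborel. ?c * (indicator {0..1} t
      * (t powr (1 - \<alpha> + real k - 1) * (1 - t) powr (1 + \<alpha> - 1))))"
  proof (intro Bochner_Integration.integral_cong_AE)
    show "AE t in lborel. ?c * (indicator {0..1} t * (t powr (- \<alpha>) * (1 - t) powr \<alpha>)) * t ^ k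
        = ?c * (indicator {0..1} t * (t powr (1 - \<alpha> + real k - 1) * (1 - t) powr (1 + \<alpha> - 1)))"
      \<comment> \<open>Merging \<open>t ^ k\<close> into the real power needs a positive base, so
        the null set \<open>{0}\<close> is discarded.\<close>
      using AE_lborel_singleton[of "0::real"]
    proof eventually_elim
      case (elim t)
      show ?case
      proof (cases "t \<in> {0..1}")
        case True
        with elim have "t powr (1 - \<alpha> + real k - 1) = t powr (- \<alpha>) * t ^ k"
          by (simp add: powr_diff powr_realpow powr_minus divide_simps)
        then show ?thesis by simp
      qed simp
    qed
  qed auto
  also have "\<dots> = ?c * Beta (1 - \<alpha> + real k) (1 + \<alpha>)"
    using has_bochner_integral_Beta[of "1 - \<alpha> + real k" "1 + \<alpha>"] assms
    by (simp add: has_bochner_integral_iff)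
  finally show ?thesis
    using gbinomial_Suc_eq_Beta[OF assms, of k] by simp
qed

section \<open>Integral form of the binomial remainder\<close>

lemma of_real_gbinomial:
  "of_real (a gchoose k) = (of_real a gchoose k :: 'a::real_field)"
  by (simp add: gbinomial_prod_rev)

lemma norm_one_plus_mult_ge:
  fixes z :: complex
  assumes "0 \<le> t" "t \<le> 1"
  shows "norm (1 + of_real t * z) \<ge> 1 - norm z"
proof -
  have "norm (of_real t * z) \<le> norm z"
    using assms by (simp add: norm_mult mult_left_le_one_le)
  then show ?thesis
    using norm_diff_ineq[of 1 "of_real t * z"] by simp
qed

text \<open>Inside the disc the denominator stays at distance at least \<open>1 - norm z\<close>
  from 0, so the kernel is bounded on the support of a finite measure.\<close>

lemma integrable_binomial_kernel:
  fixes z :: complex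
  assumes "0 < \<alpha>" "\<alpha> < 1" "norm z < 1"
  shows "integrable (binomial_measure \<alpha>) (\<lambda>t. of_real (t ^ m) / (1 + of_real t * z))"
proof -
  interpret finite_measure "binomial_measure \<alpha>"
    using assms by (intro finite_measure_binomial_measure)
  show ?thesis
  proof (rule integrable_const_bound[where B = "1 / (1 - norm z)"])
    show "AE t in binomial_measure \<alpha>. norm (of_real (t ^ m) / (1 + of_real t * z)) \<le> 1 / (1 - norm z)"
      using AE_binomial_measure
    proof eventually_elim
      case (elim t)
      then show ?case
        using norm_one_plus_mult_ge[of t z] assms(3)
        by (auto simp: norm_divide norm_power intro!: frac_le power_le_one)
    qed
  qed measurable
qed

text \<open>Writing every coefficient beyond order \<open>m\<close> as a moment turns the tail of
  the series into an integral of a geometric series with ratio \<open>- t * z\<close>.\<close>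

lemma one_plus_powr_remainder:
  fixes z :: complex
  assumes "0 < \<alpha>" "\<alpha> < 1" "norm z < 1"
  shows "(1 + z) powr of_real \<alpha> = (\<Sum>k\<le>m. (of_real \<alpha> gchoose k) * z ^ k)
    + (- 1) ^ m * z ^ Suc m * (LINT t|binomial_measure \<alpha>. of_real (t ^ m) / (1 + of_real t * z))"
proof -
  interpret finite_measure "binomial_measure \<alpha>"
    using assms by (intro finite_measure_binomial_measure)
  let ?M = "binomial_measure \<alpha>"
  \<comment> \<open>The integrand for the term of order \<open>m + 1 + j\<close>, with the common
    factor \<open>(- 1) ^ m * z ^ Suc m\<close> taken out.\<close>
  let ?F = "\<lambda>j t. complex_of_real (t ^ (m + j)) * (- z) ^ j"
  have bound: "AE t in ?M. norm (?F j t) \<le> norm z ^ j" for j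
    using AE_binomial_measure
    by eventually_elim (simp add: norm_mult norm_power power_le_one mult_left_le_one_le)
  have int: "integrable ?M (?F j)" for j
    using bound by (rule integrable_const_bound) measurable
  have sm: "summable (\<lambda>j. norm z ^ j)"
    using assms by (simp add: summable_geometric)
  \<comment> \<open>Sum and integral may be exchanged because \<open>norm z ^ j\<close> dominates
    the terms and the measure is finite.\<close>
  have "(\<lambda>j. LINT t|?M. ?F j t) sums (LINT t|?M. (\<Sum>j. ?F j t))"
  proof (rule sums_integral[OF int])
    show "AE t in ?M. summable (\<lambda>j. norm (?F j t))"
    proof -
      have "AE t in ?M. \<forall>j. norm (?F j t) \<le> norm z ^ j"
        using bound by (simp add: AE_all_countable)
      then show ?thesis
        by eventually_elim (rule summable_comparison_test'[OF sm, of 0], simp)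
    qed
    show "summable (\<lambda>j. LINT t|?M. norm (?F j t))"
    proof (rule summable_comparison_test'[OF summable_mult[OF sm, of "measure ?M UNIV"], of 0])
      fix j
      have "(LINT t|?M. norm (?F j t)) \<le> (LINT t|?M. norm z ^ j)"
        by (intro integral_mono_AE integrable_norm int bound) auto
      then show "norm (LINT t|?M. norm (?F j t)) \<le> measure ?M UNIV * norm z ^ j"
        by simp
    qed
  qed
  also have "(LINT t|?M. (\<Sum>j. ?F j t)) = (LINT t|?M. of_real (t ^ m) / (1 + of_real t * z))"
  proof (rule integral_cong_AE)
    show "AE t in ?M. (\<Sum>j. ?F j t) = of_real (t ^ m) / (1 + of_real t * z)"
      using AE_binomial_measure
    proof eventually_elim
      case (elim t)
      have "norm (- (of_real t * z)) < 1"
        using elim assms(3) mult_left_le_one_le[of "norm z" t] by (simp add: norm_mult)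
      from geometric_sums[OF this] have "(\<lambda>j. of_real (t ^ m) * (- (of_real t * z)) ^ j)
          sums (of_real (t ^ m) * (1 / (1 - - (of_real t * z))))"
        by (rule sums_mult)
      also have "(\<lambda>j. of_real (t ^ m) * (- (of_real t * z)) ^ j) = (\<lambda>j. ?F j t)"
        by (simp only: mult_minus_right[symmetric] power_mult_distrib power_add of_real_mult of_real_power mult.assoc)
      finally show ?case
        by (simp add: sums_iff)
    qed
  qed measurable
  finally have 1: "(\<lambda>j. LINT t|?M. ?F j t) sums (LINT t|?M. of_real (t ^ m) / (1 + of_real t * z))" .
  have termwise: "(- 1) ^ m * z ^ Suc m * (LINT t|?M. ?F j t) = (of_real \<alpha> gchoose (j + Suc m)) * z ^ (j + Suc m)" for j
  proof -
    have "complex_of_real \<alpha> gchoose (j + Suc m) = of_real (\<alpha> gchoose Suc (m + j))"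
      by (simp only: of_real_gbinomial add_Suc_right add.commute)
    also have "\<dots> = (- 1) ^ (m + j) * (LINT t|?M. complex_of_real (t ^ (m + j)))"
      by (simp only: gbinomial_Suc_eq_moment[OF assms(1,2)] integral_complex_of_real) simp
    finally show ?thesis
      by (simp add: power_add power_minus[of z] mult_ac del: of_real_power)
  qed
  have "(\<lambda>j. (of_real \<alpha> gchoose (j + Suc m)) * z ^ (j + Suc m)) sums
      ((- 1) ^ m * z ^ Suc m * (LINT t|?M. of_real (t ^ m) / (1 + of_real t * z)))"
    using sums_mult[OF 1, of "(- 1) ^ m * z ^ Suc m"] unfolding termwise .
  then have "(\<lambda>j. (of_real \<alpha> gchoose j) * z ^ j) sums
      ((- 1) ^ m * z ^ Suc m * (LINT t|?M. of_real (t ^ m) / (1 + of_real t * z))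
        + (\<Sum>j<Suc m. (of_real \<alpha> gchoose j) * z ^ j))"
    by (subst (asm) sums_iff_shift)
  from sums_unique2[OF gen_binomial_complex[OF assms(3)] this] show ?thesis
    by (simp only: lessThan_Suc_atMost add.commute)
qed

section \<open>Estimates for the modulus of \<open>1 + s * x\<close> on the unit circle\<close>

text \<open>The law of cosines, arranged as a defect from the value at \<open>x = 1\<close>; both
  estimates below are linear in this defect.\<close>

lemma norm_one_plus_scaled_power2:
  fixes x :: complex
  assumes "norm x = 1"
  shows "norm (1 + of_real s * x) ^ 2 = (1 + s) ^ 2 - 2 * s * (1 - Re x)"
proof -
  have "Re x ^ 2 + Im x ^ 2 = 1"
    using assms by (simp add: cmod_power2[symmetric])
  moreover have "norm (1 + of_real s * x) ^ 2 = 1 + 2 * s * Re x + s ^ 2 * (Re x ^ 2 + Im x ^ 2)"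
    unfolding cmod_power2 by (simp add: power2_eq_square algebra_simps)
  ultimately show ?thesis
    by (simp add: power2_eq_square algebra_simps)
qed

text \<open>With \<open>a\<close> and \<open>b\<close> the two denominators,
  \<open>1 / a - 1 / b = (b ^ 2 - a ^ 2) / (a * b * (a + b))\<close>, whose numerator is
  \<open>2 * s * (1 - Re x)\<close>. So it suffices that \<open>a * b * (a + b) \<ge> 4 * s\<close>,
  obtained as \<open>3 * s\<close> from \<open>a * b ^ 2\<close> plus \<open>s\<close> from
  \<open>a ^ 2 * b\<close>. The restriction on the argument of \<open>x\<close> enters here, through
  the lower bound for \<open>a\<close>.\<close>

lemma inverse_norm_one_plus_le:
  fixes x :: complex
  assumes "norm x = 1" "- 1 / 2 \<le> Re x" "0 \<le> s" "s \<le> 1"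
  shows "1 / norm (1 + of_real s * x) \<le> 1 / (1 + s) + (1 - Re x) / 2"
proof -
  define a where "a = norm (1 + of_real s * x)"
  define b where "b = 1 + s"
  have ba: "b ^ 2 - a ^ 2 = 2 * s * (1 - Re x)"
    unfolding a_def b_def norm_one_plus_scaled_power2[OF assms(1)] by simp
  then have a2: "a ^ 2 = 1 + 2 * s * Re x + s ^ 2"
    by (simp add: b_def power2_eq_square algebra_simps)
  have a2ge: "a ^ 2 \<ge> 1 - s + s ^ 2"
    using mult_left_mono[OF assms(2), of s] assms(3) unfolding a2 by simp
  \<comment> \<open>Completing the square, \<open>1 - s + s ^ 2 = (s - 1/2) ^ 2 + 3/4\<close>, which
    exceeds \<open>9/16\<close>.\<close>
  have "(3 / 4) ^ 2 \<le> a ^ 2"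
    using a2ge sum_squares_ge_zero[of "s - 1/2" 0] by (simp add: power2_eq_square algebra_simps)
  then have a34: "a \<ge> 3 / 4"
    by (rule power2_le_imp_le) (simp add: a_def)
  have b: "b \<ge> 1" using assms by (simp add: b_def)
  have "4 * s \<le> b ^ 2"
    using sum_squares_ge_zero[of "s - 1" 0] by (simp add: b_def power2_eq_square algebra_simps)
  then have 1: "3 * s \<le> a * b ^ 2"
    using mult_mono[OF a34, of "4 * s" "b ^ 2"] assms(3) by (simp add: a_def)
  have "(1 - s + s ^ 2) * (1 + s) \<le> a ^ 2 * b"
    unfolding b_def by (rule mult_right_mono[OF a2ge]) (use assms in simp)
  \<comment> \<open>The product is a sum of cubes, hence at least 1 and so at least
    \<open>s\<close>.\<close>
  moreover have "(1 - s + s ^ 2) * (1 + s) = 1 + s ^ 3"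
    by (simp add: algebra_simps power2_eq_square power3_eq_cube)
  ultimately have 2: "s \<le> a ^ 2 * b"
    using assms by (smt (verit) zero_le_power)
  have ab: "4 * s \<le> a * b * (a + b)"
    using 1 2 by (simp add: algebra_simps power2_eq_square)
  have pos: "0 < a * b * (a + b)" "a > 0" "b > 0"
    using a34 b by auto
  have u: "0 \<le> 1 - Re x"
    using complex_Re_le_cmod[of x] assms(1) by simp
  have "1 / a - 1 / b = (b ^ 2 - a ^ 2) / (a * b * (a + b))"
    using pos by (simp add: divide_simps) (simp add: power2_eq_square algebra_simps)
  also have "\<dots> = (1 - Re x) / 2 * (4 * s) / (a * b * (a + b))"
    unfolding ba by simp
  also have "\<dots> \<le> (1 - Re x) / 2"
    using mult_left_mono[OF ab, of "(1 - Re x) / 2"] u pos(1) by (subst pos_divide_le_eq) auto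
  finally have "1 / a \<le> 1 / b + (1 - Re x) / 2"
    by linarith
  then show ?thesis
    unfolding a_def b_def .
qed

text \<open>Concavity of the power \<open>\<alpha> / 2\<close> on squared moduli: weighted AM-GM
  with weights \<open>\<alpha> / 2\<close> and \<open>1 - \<alpha> / 2\<close> makes the bound
  linear in the known defect \<open>b ^ 2 - a ^ 2\<close>.\<close>

lemma norm_one_plus_powr_le:
  fixes x :: complex
  assumes "norm x = 1" "0 < \<alpha>" "\<alpha> < 1" "0 \<le> r" "r < 1"
  shows "norm (1 + of_real r * x) powr \<alpha> \<le> (1 + r) powr \<alpha> - \<alpha> * r * (1 - Re x) / 4"
proof -
  define a where "a = norm (1 + of_real r * x)"
  define b where "b = 1 + r"
  have a2: "a ^ 2 = b ^ 2 - 2 * r * (1 - Re x)"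
    unfolding a_def b_def by (rule norm_one_plus_scaled_power2[OF assms(1)])
  have "1 - r \<le> a"
    using norm_diff_ineq[of 1 "of_real r * x"] assms unfolding a_def by (simp add: norm_mult)
  then have a: "a > 0"
    using assms by simp
  have b: "1 \<le> b" "b ^ 2 \<le> 4"
    using assms power_mono[of b 2 2] by (auto simp: b_def)
  have u: "0 \<le> 1 - Re x"
    using complex_Re_le_cmod[of x] assms(1) by simp
  have "(a ^ 2) powr (\<alpha> / 2) * (b ^ 2) powr (1 - \<alpha> / 2) \<le> \<alpha> / 2 * a ^ 2 + (1 - \<alpha> / 2) * b ^ 2"
    using a b assms by (intro Youngs_inequality_0) auto
  also have "\<dots> = b ^ 2 - \<alpha> * r * (1 - Re x)"
    unfolding a2 by (simp add: algebra_simps)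
  also have "(a ^ 2) powr (\<alpha> / 2) = a powr \<alpha>"
    using a by (simp add: powr_powr flip: powr_numeral)
  also have "(b ^ 2) powr (1 - \<alpha> / 2) = b ^ 2 / b powr \<alpha>"
    using b by (simp add: powr_powr algebra_simps powr_diff flip: powr_numeral)
  finally have "a powr \<alpha> \<le> b powr \<alpha> * ((b ^ 2 - \<alpha> * r * (1 - Re x)) / b ^ 2)"
    using b by (simp add: field_simps)
  also have "\<dots> = b powr \<alpha> - b powr \<alpha> * (\<alpha> * r * (1 - Re x) / b ^ 2)"
    using b by (simp add: field_simps)
  \<comment> \<open>The constant 4 is the bound for \<open>b ^ 2\<close>, since
    \<open>1 \<le> b \<le> 2\<close>; also \<open>b powr \<alpha> \<ge> 1\<close>.\<close>
  also have "\<dots> \<le> b powr \<alpha> - \<alpha> * r * (1 - Re x) / 4"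
  proof -
    have "1 * (\<alpha> * r * (1 - Re x) / 4) \<le> b powr \<alpha> * (\<alpha> * r * (1 - Re x) / b ^ 2)"
      using b u assms by (intro mult_mono divide_left_mono) (auto simp: ge_one_powr_ge_zero)
    then show ?thesis by simp
  qed
  finally show ?thesis
    unfolding a_def b_def by simp
qed

section \<open>Moment bound and comparison inside the disc\<close>

lemma integrable_power_binomial_measure:
  assumes "0 < \<alpha>" "\<alpha> < 1"
  shows "integrable (binomial_measure \<alpha>) (\<lambda>t. t ^ k)"
proof -
  interpret finite_measure "binomial_measure \<alpha>"
    using assms by (rule finite_measure_binomial_measure)
  show ?thesis
  proof (rule integrable_const_bound[where B = 1])
    show "AE t in binomial_measure \<alpha>. norm (t ^ k) \<le> 1"
      using AE_binomial_measure by eventually_elim (simp add: norm_power power_le_one)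
  qed measurable
qed

text \<open>On the unit interval moments decrease with the order, and the first one is read off from
  the binomial coefficient of order 2.\<close>

lemma moment_binomial_measure_le:
  assumes "0 < \<alpha>" "\<alpha> < 1" "m \<ge> 1"
  shows "(LINT t|binomial_measure \<alpha>. t ^ m) \<le> \<alpha> / 2"
proof -
  have "(LINT t|binomial_measure \<alpha>. t ^ m) \<le> (LINT t|binomial_measure \<alpha>. t ^ 1)"
  proof (rule integral_mono_AE)
    show "AE t in binomial_measure \<alpha>. t ^ m \<le> t ^ 1"
      using AE_binomial_measure
      by eventually_elim (use assms(3) in \<open>auto intro!: power_decreasing simp del: power_one_right One_nat_def\<close>)
  qed (intro integrable_power_binomial_measure assms)+
  also have "(LINT t|binomial_measure \<alpha>. t ^ 1) = \<alpha> * (1 - \<alpha>) / 2"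
    using gbinomial_Suc_eq_moment[OF assms(1,2), of 1]
    by (simp add: gbinomial_prod_rev numeral_2_eq_2 field_simps)
  also have "\<dots> \<le> \<alpha> / 2"
    using assms by (simp add: mult_left_le)
  finally show ?thesis .
qed

text \<open>Oddness makes the remainder enter with a plus sign, so that for
  \<open>z = r \<ge> 0\<close> both summands are nonnegative reals and nothing cancels.\<close>

lemma A_coeff_odd_eq:
  fixes z :: complex
  assumes "0 < \<alpha>" "\<alpha> < 1" "norm z < 1" "odd m"
  shows "A_coeff m \<alpha> z = (1 + z) powr of_real \<alpha>
    + z ^ Suc m * (LINT t|binomial_measure \<alpha>. of_real (t ^ m) / (1 + of_real t * z))"
proof -
  have "A_coeff m \<alpha> z = (\<Sum>k\<le>m. (of_real \<alpha> gchoose k) * z ^ k)"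
    unfolding A_coeff_eq_sum
    by (intro sum.cong refl) (simp add: gbinomial_pochhammer power_minus[of z] mult_ac)
  then show ?thesis
    using one_plus_powr_remainder[OF assms(1-3), of m] assms(4) by simp
qed

lemma norm_A_coeff_scaled_le:
  fixes x :: complex
  assumes "norm x = 1" "- 1 / 2 \<le> Re x" "0 < \<alpha>" "\<alpha> < 1" "odd m" "0 \<le> r" "r < 1"
  shows "norm (A_coeff m \<alpha> (of_real r * x)) \<le> Re (A_coeff m \<alpha> (of_real r))"
proof -
  let ?M = "binomial_measure \<alpha>"
  define u where "u = 1 - Re x"
  define K where "K = (\<lambda>z::complex. LINT t|?M. of_real (t ^ m) / (1 + of_real t * z))"
  define R where "R = (LINT t|?M. t ^ m / (1 + t * r))"
  have m: "m \<ge> 1" using assms(5) by (cases m) auto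
  have u: "0 \<le> u"
    using complex_Re_le_cmod[of x] assms(1) by (simp add: u_def)
  have rx: "norm (of_real r * x) < 1"
    using assms by (simp add: norm_mult)
  have kernel_r: "complex_of_real (t ^ m) / (1 + of_real t * of_real r) = of_real (t ^ m / (1 + t * r))" for t
    by simp
  have KR: "K (of_real r) = of_real R"
    unfolding K_def R_def kernel_r by (rule integral_complex_of_real)
  have intR: "integrable ?M (\<lambda>t. t ^ m / (1 + t * r))"
    using integrable_Re[OF integrable_binomial_kernel[of \<alpha> "of_real r" m]] assms
    unfolding kernel_r by simp
  have intm: "integrable ?M (\<lambda>t. t ^ m)"
    using assms by (intro integrable_power_binomial_measure)
  have "norm (K (of_real r * x)) \<le> (LINT t|?M. norm (complex_of_real (t ^ m) / (1 + of_real t * (of_real r * x))))"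
    unfolding K_def by (rule integral_norm_bound)
  also have "\<dots> \<le> (LINT t|?M. t ^ m / (1 + t * r) + u / 2 * t ^ m)"
  proof (rule integral_mono_AE)
    show "integrable ?M (\<lambda>t. norm (complex_of_real (t ^ m) / (1 + of_real t * (of_real r * x))))"
      using assms rx by (intro integrable_norm integrable_binomial_kernel)
    show "integrable ?M (\<lambda>t. t ^ m / (1 + t * r) + u / 2 * t ^ m)"
      using intR intm by (intro Bochner_Integration.integrable_add integrable_mult_right)
    show "AE t in ?M. norm (complex_of_real (t ^ m) / (1 + of_real t * (of_real r * x)))
        \<le> t ^ m / (1 + t * r) + u / 2 * t ^ m"
      using AE_binomial_measure
    proof eventually_elim
      case (elim t)
      \<comment> \<open>The reciprocal estimate is applied with \<open>s = t * r\<close>.\<close>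
      then have "0 \<le> t * r" "t * r \<le> 1"
        using assms by (auto intro: mult_le_one)
      from mult_left_mono[OF inverse_norm_one_plus_le[OF assms(1,2) this], of "t ^ m"] elim
      show ?case
        by (simp add: norm_divide norm_power u_def algebra_simps)
    qed
  qed
  also have "\<dots> = R + u / 2 * (LINT t|?M. t ^ m)"
    unfolding R_def using intR intm by simp
  also have "\<dots> \<le> R + u / 2 * (\<alpha> / 2)"
    using moment_binomial_measure_le[OF assms(3,4) m] u by (intro add_left_mono mult_left_mono) auto
  finally have K: "norm (K (of_real r * x)) \<le> R + \<alpha> * u / 4"
    by (simp add: mult_ac)
  \<comment> \<open>The gain \<open>\<alpha> * u / 4\<close> carries the factor
    \<open>r ^ Suc m\<close>, the loss only \<open>r\<close>; this inequality lets the loss absorb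
    the gain.\<close>
  have r: "r ^ Suc m \<le> r"
    using assms by (simp add: power_le_one mult_left_le)
  have "norm (A_coeff m \<alpha> (of_real r * x))
      \<le> norm ((1 + of_real r * x) powr of_real \<alpha>) + norm ((of_real r * x) ^ Suc m * K (of_real r * x))"
    unfolding K_def A_coeff_odd_eq[OF assms(3,4) rx assms(5)] by (rule norm_triangle_ineq)
  also have "\<dots> = norm (1 + of_real r * x) powr \<alpha> + r ^ Suc m * norm (K (of_real r * x))"
    using assms by (simp add: norm_powr_real_powr' norm_mult norm_power del: power_Suc)
  also have "\<dots> \<le> ((1 + r) powr \<alpha> - \<alpha> * r * (1 - Re x) / 4) + r ^ Suc m * (R + \<alpha> * u / 4)"
    using assms K by (intro add_mono norm_one_plus_powr_le mult_left_mono) auto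
  also have "\<dots> \<le> (1 + r) powr \<alpha> + r ^ Suc m * R"
    using mult_right_mono[OF r, of "\<alpha> * u / 4"] assms u by (simp add: u_def algebra_simps)
  also have "\<dots> = Re (A_coeff m \<alpha> (of_real r))"
  proof -
    have "(1 + complex_of_real r) powr of_real \<alpha> = of_real ((1 + r) powr \<alpha>)"
      using assms powr_of_real[of "1 + r" \<alpha>] by simp
    then have "A_coeff m \<alpha> (of_real r) = of_real ((1 + r) powr \<alpha> + r ^ Suc m * R)"
      using A_coeff_odd_eq[of \<alpha> "of_real r" m] assms KR by (simp add: K_def)
    then show ?thesis by (simp only: Re_complex_of_real)
  qed
  finally show ?thesis .
qed

section \<open>Passage to the unit circle\<close>

theorem corollary1:
  fixes x :: complex and \<alpha> :: real and n :: nat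
  assumes "norm x = 1"
    and "\<bar>Arg x\<bar> \<le> 2 * pi / 3"
    and "0 < \<alpha>" and "\<alpha> < 1"
    and "n \<ge> 1"
  shows "norm (A_coeff (2 * n - 1) \<alpha> x) \<le> Re (A_coeff (2 * n - 1) \<alpha> 1)"
proof -
  let ?m = "2 * n - 1"
  \<comment> \<open>Cosine is even and decreasing on \<open>[0, pi]\<close>, so the bound on the
    argument becomes a bound on the real part.\<close>
  have "cos (2 * pi / 3) \<le> cos \<bar>Arg x\<bar>"
    using assms(2) by (intro cos_monotone_0_pi_le) auto
  moreover have "cos \<bar>Arg x\<bar> = Re x"
    using cos_Arg[of x] assms(1) by (cases "x = 0") auto
  ultimately have x: "- 1 / 2 \<le> Re x"
    by (simp add: cos_120)
  have m: "odd ?m" using assms(5) by simp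
  \<comment> \<open>As a finite sum \<open>A_coeff\<close> is a polynomial in its last argument, so
    the inequality survives the limit to radius 1, although the integral formula was derived only
    inside the disc.\<close>
  have cont: "((\<lambda>r. A_coeff ?m \<alpha> (of_real r * y)) \<longlongrightarrow> A_coeff ?m \<alpha> (of_real 1 * y)) (at_left 1)" for y
    unfolding A_coeff_eq_sum by (intro tendsto_intros) auto
  have ev: "\<forall>\<^sub>F r in at_left (1::real). 0 \<le> r \<and> r < 1"
    unfolding eventually_at_left_field by (rule exI[of _ 0]) auto
  have "norm (A_coeff ?m \<alpha> (of_real 1 * x)) \<le> Re (A_coeff ?m \<alpha> (of_real 1 * 1))"
  proof (rule tendsto_le)
    show "((\<lambda>r. norm (A_coeff ?m \<alpha> (of_real r * x))) \<longlongrightarrow> norm (A_coeff ?m \<alpha> (of_real 1 * x))) (at_left 1)"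
      by (intro tendsto_norm cont)
    show "((\<lambda>r. Re (A_coeff ?m \<alpha> (of_real r * 1))) \<longlongrightarrow> Re (A_coeff ?m \<alpha> (of_real 1 * 1))) (at_left 1)"
      by (intro tendsto_Re cont)
    show "\<forall>\<^sub>F r in at_left 1. norm (A_coeff ?m \<alpha> (of_real r * x)) \<le> Re (A_coeff ?m \<alpha> (of_real r * 1))"
      using ev by eventually_elim (use norm_A_coeff_scaled_le[OF assms(1) x assms(3,4) m] in simp)
  qed simp
  then show ?thesis by simp
qed

end
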